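(* Assume the static scheduling policy is used and all device deadlines are met. For the $i$-th leaf-to-root path $(n_p)_{p=1}^{P_i}\in\mathbb P_m$ of the $m$-th tree and a final leaf Handle release index $k_{2P_i-1}\in\mathbb K_{n_1}$, define integers $(k_j)_{j=1}^{2P_i-1}$ recursively backward as follows. Downward Handle propagation: for $v=P_i-1,\dots,1$, $$k_{P_i+v-1}=\begin{cases}\left\lfloor\dfrac{k_{P_i+v}\,\delta}{\mathcal T_{n_{P_i-v+1}}}\right\rfloor\dfrac{\mathcal T_{n_{P_i-v+1}}}{\delta},&\text{if }\mathcal H_{i,v}\text{ holds},\\[12pt]\left\lfloor\dfrac{k_{P_i+v}\,\delta-\widehat{\mathcal R}^{-}_{n_{P_i-v+1}}}{\mathcal T_{n_{P_i-v+1}}}\right\rfloor\dfrac{\mathcal T_{n_{P_i-v+1}}}{\delta},&\text{otherwise}.\end{cases}$$ Upward Update propagation: for $u=P_i,\dots,2$, $$k_{u-1}=\begin{cases}\left\lfloor\dfrac{k_{u}\,\delta}{\mathcal T_{n_{u-1}}}\right\rfloor\dfrac{\mathcal T_{n_{u-1}}}{\delta},&\text{if }\mathcal U_{i,u}\text{ holds},\\[12pt]\left\lfloor\dfrac{k_{u}\,\delta-\widehat{\mathcal R}^{+}_{n_{u-1}}}{\mathcal T_{n_{u-1}}}\right\rfloor\dfrac{\mathcal T_{n_{u-1}}}{\delta},&\text{otherwise}.\end{cases}$$ Then the intra-tree decision latency of the $m$-th tree satisfies $$L_m\le\max_{(n_p)_{p=1}^{P_i}\in\mathbb P_m}\ \max_{k_{2P_i-1}\in\mathbb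 K_{n_1}}\left(k_{2P_i-1}\delta+\widehat{\mathcal R}^{-}_{n_1}-k_1\delta\right),$$ where $k_1$ is the first release index obtained by the backward recurrence for the corresponding path and final release.
   Context: Platform: one processor core, fully preemptive fixed-priority scheduling starting at time $0$, scheduling tick $\delta>0$. Devices: $\mathbb D=\{d_1,\dots,d_N\}$. Device $d_n$ has a period $\mathcal T_n$, a positive integer multiple of $\delta$, and relative deadline $\mathcal D_n=\mathcal T_n$. It releases a task at every time $k\delta$ with $k\in\mathbb K_n=\{k\in\mathbb N: k\delta=\alpha\mathcal T_n\text{ for some }\alpha\in\mathbb N\}$. Each task consists of an Update stage $\tau_n^+$ and a Handle stage $\tau_n^-$, with positive worst-case execution times (WCETs) $\mathcal C_n^+,\mathcal C_n^-$; $\mathcal C_n=\mathcal C_n^++\mathcal C_n^-$. For $\circ\in\{+,-\}$ and $k\in\mathbb K_n$, $S(\tau_n^\circ,k)$ and $F(\tau_n^\circ,k)$ are the start and finish times of the instance of $\tau_n^\circ$ released at $k\delta$. Deadlines being met means $F(\tau_n^-,k)\le k\delta+\mathcal D_n$ for all $n$ and $k\in\mathbb K_n$. Forest: $\mathbb E$ is a set of ordered pairs $(d_a,d_b)$ meaning $d_b$ depends on $d_a$ ($d_a$ is the child, $d_b$ the parent); $(\mathbb D,\mathbb E)$ is a forest with trees $(\mathbb D_m,\mathbb E_m)$, $m=1,\dots,M$. A leaf-to-root path of the $m$-th tree is an index sequence $(n_p)_{p=1}^{P}$ with $d_{n_p}\in\mathbb D_m$, $(d_{n_p},d_{n_{p+1}})\in\mathbb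 E_m$ for $p=1,\dots,P-1$, $d_{n_1}$ a leaf and $d_{n_P}$ the root; $\mathbb P_m$ is the set of these paths, and $P_i$ is the length of the $i$-th path. Static policy: $\mathcal I:\mathbb D\to\{1,\dots,N\}$ is a bijection (initialization rank). Let $\mathcal T^{(1)}<\dots<\mathcal T^{(W)}$ be the distinct device periods; bucket $\mathbf Q_w$ is the sequence, by increasing $\mathcal I$, of all devices with period $\mathcal T^{(w)}$, and $\mathcal C^{\mathbf Q}_w=\sum_{d_n\in\mathbf Q_w}\mathcal C_n$. At each release, bucket $\mathbf Q_w=(d_{a_1},\dots,d_{a_r})$ executes $\tau_{a_1}^+,\dots,\tau_{a_r}^+,\tau_{a_r}^-,\dots,\tau_{a_1}^-$ in this order. Buckets with shorter period have higher priority and preempt buckets with longer period. In addition there are $N_{\mathcal B}$ bus objects with priority over all buckets; bus $\beta$ generates responses whose releases are separated by at least $\mathcal T^{\mathcal B}_\beta>0$, each needing at most $\mathcal C^{\mathcal B}_\beta$ execution; $\mathcal P^{\mathcal B}_\beta=\min\{\mathcal T^{\mathcal B}_\beta,\delta\}$. Response-time bounds: for $\circ\in\{+,-\}$, $\widehat{\mathcal R}_n^\circ$ is the least fixed point (assumed to exist) of $$R=\mathcal B_n^\circ+\sum_{\beta=1}^{N_{\mathcal B}}\left\lceil\frac{R}{\mathcal P^{\mathcal B}_\beta}\right\rceil\mathcal C^{\mathcal B}_\beta+\sum_{w:\mathcal T^{(w)}<\mathcal T_n}\left\lceil\frac{R}{\mathcal T^{(w)}}\right\rceil\mathcal C^{\mathbf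 Q}_w,$$ where $\mathcal B_n^+=\mathcal C_n^++\sum_{u:\mathcal T_u=\mathcal T_n,\ \mathcal I(d_u)<\mathcal I(d_n)}\mathcal C_u^+$ and $\mathcal B_n^-=\sum_{u:\mathcal T_u=\mathcal T_n}\mathcal C_u^++\sum_{u:\mathcal T_u=\mathcal T_n,\ \mathcal I(d_u)>\mathcal I(d_n)}\mathcal C_u^-+\mathcal C_n^-$. Predicates for the $i$-th path: for $u=2,\dots,P_i$, $\mathcal U_{i,u}$ holds iff $\mathcal T_{n_{u-1}}<\mathcal T_{n_u}$, or $\mathcal T_{n_{u-1}}=\mathcal T_{n_u}$ and $\mathcal I(d_{n_{u-1}})<\mathcal I(d_{n_u})$. For $v=1,\dots,P_i-1$, $\mathcal H_{i,v}$ holds iff $\mathcal T_{n_{P_i-v+1}}<\mathcal T_{n_{P_i-v}}$, or $\mathcal T_{n_{P_i-v+1}}=\mathcal T_{n_{P_i-v}}$ and $\mathcal I(d_{n_{P_i-v+1}})>\mathcal I(d_{n_{P_i-v}})$. Data transfer relation: $(\tau_a^\circ,k_1)\prec(\tau_b^\circ,k_2)$ iff $(d_a,d_b)\in\mathbb E$ when $\circ=+$, respectively $(d_b,d_a)\in\mathbb E$ when $\circ=-$, and $k_1=\max\{k\in\mathbb K_a: F(\tau_a^\circ,k)\le S(\tau_b^\circ,k_2)\}$. Latency: for a path $(n_p)_{p=1}^{P_i}\in\mathbb P_m$ and terminal index $\kappa_{2P_i-1}\in\mathbb K_{n_1}$, the exact release indices are determined backward by $(\tau_{n_{P_i}}^-,\kappa_{P_i})\prec(\tau_{n_{P_i-1}}^-,\kappa_{P_i+1})\prec\dots\prec(\tau_{n_1}^-,\kappa_{2P_i-1})$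 and then $(\tau_{n_1}^+,\kappa_1)\prec(\tau_{n_2}^+,\kappa_2)\prec\dots\prec(\tau_{n_{P_i}}^+,\kappa_{P_i})$. The intra-tree decision latency $L_m$ is the maximum (supremum), over all paths in $\mathbb P_m$ and all terminal indices for which this sequence exists, of $F(\tau_{n_1}^-,\kappa_{2P_i-1})-S(\tau_{n_1}^+,\kappa_1)$. The $k_j$ of the claim's recurrence are integers that may be negative; maxima over infinite sets are read as suprema. *)

theory Defs
  imports "HOL-Analysis.Analysis"
begin

datatype stage = Update | Handle

text \<open>Devices are represented by their indices \<open>1, \<dots>, num_devices\<close>; a device period is given as a
  number of ticks.  An edge \<open>(a, b)\<close> says that \<open>b\<close> (the parent) depends on \<open>a\<close> (the child).\<close>

record system =
  tick :: real
  num_devices :: nat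
  period_ticks :: "nat \<Rightarrow> nat"
  wcet :: "stage \<Rightarrow> nat \<Rightarrow> real"
  edges :: "(nat \<times> nat) set"
  init_rank :: "nat \<Rightarrow> nat"
  num_buses :: nat
  bus_separation :: "nat \<Rightarrow> real"
  bus_wcet :: "nat \<Rightarrow> real"

definition devices :: "system \<Rightarrow> nat set" where
  "devices sys = {1..num_devices sys}"

definition buses :: "system \<Rightarrow> nat set" where
  "buses sys = {1..num_buses sys}"

definition period :: "system \<Rightarrow> nat \<Rightarrow> real" where
  "period sys n = real (period_ticks sys n) * tick sys"

definition release_indices :: "system \<Rightarrow> nat \<Rightarrow> nat set" where
  "release_indices sys n = {k. \<exists>\<alpha>::nat. real k * tick sys = real \<alpha> * period sys n}"

definition device_wcet :: "system \<Rightarrow> nat \<Rightarrow> real" where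
  "device_wcet sys n = wcet sys Update n + wcet sys Handle n"

text \<open>A rooted forest whose edges point from child to parent: there are no directed cycles and every
  device has at most one parent.\<close>

definition forest :: "nat set \<Rightarrow> (nat \<times> nat) set \<Rightarrow> bool" where
  "forest V E \<longleftrightarrow> E \<subseteq> V \<times> V \<and> acyclic E \<and> single_valued E"

definition wf_system :: "system \<Rightarrow> bool" where
  "wf_system sys \<longleftrightarrow>
     tick sys > 0 \<and>
     (\<forall>n\<in>devices sys. period_ticks sys n > 0) \<and>
     (\<forall>n\<in>devices sys. \<forall>s. wcet sys s n > 0) \<and>
     forest (devices sys) (edges sys) \<and>
     bij_betw (init_rank sys) (devices sys) {1..num_devices sys} \<and>
     (\<forall>\<beta>\<in>buses sys. bus_separation sys \<beta> > 0 \<and> bus_wcet sys \<beta> \<ge> 0)"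

text \<open>The vertex sets of the trees are the weakly connected components.\<close>

definition trees :: "system \<Rightarrow> nat set set" where
  "trees sys = devices sys //
     {(a, b) \<in> devices sys \<times> devices sys. (a, b) \<in> (edges sys \<union> (edges sys)\<inverse>)\<^sup>*}"

definition tree_edges :: "system \<Rightarrow> nat set \<Rightarrow> (nat \<times> nat) set" where
  "tree_edges sys V = edges sys \<inter> V \<times> V"

text \<open>Paths are lists; \<open>node xs p\<close> is the \<open>p\<close>-th device of the path, counting from 1.\<close>

definition node :: "nat list \<Rightarrow> nat \<Rightarrow> nat" where
  "node xs p = xs ! (p - 1)"

definition leaf_root_paths :: "system \<Rightarrow> nat set \<Rightarrow> nat list set" where
  "leaf_root_paths sys V =
     {xs. xs \<noteq> [] \<and> set xs \<subseteq> V \<and>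
          (\<forall>p\<in>{1..length xs - 1}. (node xs p, node xs (p + 1)) \<in> tree_edges sys V) \<and>
          (\<nexists>a. (a, node xs 1) \<in> tree_edges sys V) \<and>
          (\<nexists>b. (node xs (length xs), b) \<in> tree_edges sys V)}"


text \<open>Buckets are indexed by their period \<open>T\<close>.\<close>

definition bucket :: "system \<Rightarrow> real \<Rightarrow> nat list" where
  "bucket sys T =
     sort_key (init_rank sys) (filter (\<lambda>n. period sys n = T) [1..<Suc (num_devices sys)])"

definition bucket_program :: "system \<Rightarrow> real \<Rightarrow> (stage \<times> nat) list" where
  "bucket_program sys T =
     map (\<lambda>n. (Update, n)) (bucket sys T) @ map (\<lambda>n. (Handle, n)) (rev (bucket sys T))"

definition occurs_before :: "'a list \<Rightarrow> 'a \<Rightarrow> 'a \<Rightarrow> bool" where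
  "occurs_before xs x y \<longleftrightarrow> (\<exists>i j. i < j \<and> j < length xs \<and> xs ! i = x \<and> xs ! j = y)"

text \<open>\<open>Stage s n k\<close> is the instance of stage \<open>s\<close> of device \<open>n\<close> with release index \<open>k\<close>;
  \<open>Bus \<beta> r\<close> is the response of bus \<open>\<beta>\<close> released at time \<open>r\<close>.\<close>

datatype job = Stage stage nat nat | Bus nat real

text \<open>No order is imposed between bus responses, nor between instances of one bucket with different
  release indices; the latter are never pending together when deadlines are met.\<close>

fun has_priority :: "system \<Rightarrow> job \<Rightarrow> job \<Rightarrow> bool" where
  "has_priority sys (Bus \<beta> r) (Stage s n k) \<longleftrightarrow> True"
| "has_priority sys (Stage s n k) (Stage s' n' k') \<longleftrightarrow>
     period sys n < period sys n' \<or>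
     (period sys n = period sys n' \<and> k = k' \<and>
      occurs_before (bucket_program sys (period sys n)) (s, n) (s', n'))"
| "has_priority sys j (Bus \<beta> r) \<longleftrightarrow> False"

text \<open>One run of the platform: the bus release times, the execution time each job actually needs,
  and the job occupying the processor at each time.\<close>

record run =
  bus_releases :: "nat \<Rightarrow> real set"
  exec_time :: "job \<Rightarrow> real"
  sched :: "real \<Rightarrow> job option"

definition jobs :: "system \<Rightarrow> run \<Rightarrow> job set" where
  "jobs sys \<rho> =
     {Stage s n k | s n k. n \<in> devices sys \<and> k \<in> release_indices sys n} \<union>
     {Bus \<beta> r | \<beta> r. \<beta> \<in> buses sys \<and> r \<in> bus_releases \<rho> \<beta>}"

fun release_time :: "system \<Rightarrow> job \<Rightarrow> real" where
  "release_time sys (Stage s n k) = real k * tick sys"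
| "release_time sys (Bus \<beta> r) = r"

fun job_wcet :: "system \<Rightarrow> job \<Rightarrow> real" where
  "job_wcet sys (Stage s n k) = wcet sys s n"
| "job_wcet sys (Bus \<beta> r) = bus_wcet sys \<beta>"

definition occupied :: "run \<Rightarrow> job \<Rightarrow> real set" where
  "occupied \<rho> j = {t. 0 \<le> t \<and> sched \<rho> t = Some j}"

definition service :: "run \<Rightarrow> job \<Rightarrow> real \<Rightarrow> real" where
  "service \<rho> j t = measure lebesgue (occupied \<rho> j \<inter> {0..t})"

definition pending :: "system \<Rightarrow> run \<Rightarrow> job \<Rightarrow> real \<Rightarrow> bool" where
  "pending sys \<rho> j t \<longleftrightarrow>
     j \<in> jobs sys \<rho> \<and> release_time sys j \<le> t \<and> service \<rho> j t < exec_time \<rho> j"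

text \<open>Stage instances need a positive amount of execution, so that their start is meaningful;
  bus responses may need none.\<close>

definition wf_workload :: "system \<Rightarrow> run \<Rightarrow> bool" where
  "wf_workload sys \<rho> \<longleftrightarrow>
     (\<forall>\<beta>\<in>buses sys. \<forall>r\<in>bus_releases \<rho> \<beta>. 0 \<le> r) \<and>
     (\<forall>\<beta>\<in>buses sys. \<forall>r\<in>bus_releases \<rho> \<beta>. \<forall>r'\<in>bus_releases \<rho> \<beta>.
        r \<noteq> r' \<longrightarrow> bus_separation sys \<beta> \<le> \<bar>r - r'\<bar>) \<and>
     (\<forall>j\<in>jobs sys \<rho>. 0 \<le> exec_time \<rho> j \<and> exec_time \<rho> j \<le> job_wcet sys j) \<and>
     (\<forall>s n k. Stage s n k \<in> jobs sys \<rho> \<longrightarrow> 0 < exec_time \<rho> (Stage s n k))"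

definition static_policy :: "system \<Rightarrow> run \<Rightarrow> bool" where
  "static_policy sys \<rho> \<longleftrightarrow>
     (\<forall>j. occupied \<rho> j \<in> sets lebesgue) \<and>
     (\<forall>t\<ge>0. case sched \<rho> t of
         None \<Rightarrow> (\<nexists>j. pending sys \<rho> j t)
       | Some j \<Rightarrow> pending sys \<rho> j t \<and>
                  (\<nexists>j'. pending sys \<rho> j' t \<and> has_priority sys j' j))"

text \<open>Start and finish times are infinite for instances that never start or finish.\<close>

definition start_time :: "run \<Rightarrow> stage \<Rightarrow> nat \<Rightarrow> nat \<Rightarrow> ereal" where
  "start_time \<rho> s n k = (INF t\<in>occupied \<rho> (Stage s n k). ereal t)"

definition finish_time :: "run \<Rightarrow> stage \<Rightarrow> nat \<Rightarrow> nat \<Rightarrow> ereal" where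
  "finish_time \<rho> s n k =
     (INF t\<in>{t. 0 \<le> t \<and> exec_time \<rho> (Stage s n k) \<le> service \<rho> (Stage s n k) t}. ereal t)"

definition deadlines_met :: "system \<Rightarrow> run \<Rightarrow> bool" where
  "deadlines_met sys \<rho> \<longleftrightarrow>
     (\<forall>n\<in>devices sys. \<forall>k\<in>release_indices sys n.
        finish_time \<rho> Handle n k \<le> ereal (real k * tick sys + period sys n))"


fun own_demand :: "system \<Rightarrow> stage \<Rightarrow> nat \<Rightarrow> real" where
  "own_demand sys Update n =
     wcet sys Update n +
     (\<Sum>u\<in>{u\<in>devices sys. period sys u = period sys n \<and> init_rank sys u < init_rank sys n}.
        wcet sys Update u)"
| "own_demand sys Handle n =
     (\<Sum>u\<in>{u\<in>devices sys. period sys u = period sys n}. wcet sys Update u) +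
     (\<Sum>u\<in>{u\<in>devices sys. period sys u = period sys n \<and> init_rank sys u > init_rank sys n}.
        wcet sys Handle u) +
     wcet sys Handle n"

definition bus_period :: "system \<Rightarrow> nat \<Rightarrow> real" where
  "bus_period sys \<beta> = min (bus_separation sys \<beta>) (tick sys)"

definition bucket_wcet :: "system \<Rightarrow> real \<Rightarrow> real" where
  "bucket_wcet sys T = (\<Sum>n\<in>set (bucket sys T). device_wcet sys n)"

definition demand :: "system \<Rightarrow> stage \<Rightarrow> nat \<Rightarrow> real \<Rightarrow> real" where
  "demand sys s n R =
     own_demand sys s n +
     (\<Sum>\<beta>\<in>buses sys. of_int \<lceil>R / bus_period sys \<beta>\<rceil> * bus_wcet sys \<beta>) +
     (\<Sum>T\<in>{T \<in> period sys ` devices sys. T < period sys n}.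
        of_int \<lceil>R / T\<rceil> * bucket_wcet sys T)"

text \<open>Only nonnegative fixed points count: response times are nonnegative, whereas the equation can
  also have spurious negative solutions.\<close>

definition is_least_response :: "system \<Rightarrow> stage \<Rightarrow> nat \<Rightarrow> real \<Rightarrow> bool" where
  "is_least_response sys s n R \<longleftrightarrow>
     0 \<le> R \<and> R = demand sys s n R \<and> (\<forall>R'\<ge>0. R' = demand sys s n R' \<longrightarrow> R \<le> R')"

definition response_bound :: "system \<Rightarrow> stage \<Rightarrow> nat \<Rightarrow> real" where
  "response_bound sys s n = (THE R. is_least_response sys s n R)"

definition response_bounds_exist :: "system \<Rightarrow> bool" where
  "response_bounds_exist sys \<longleftrightarrow> (\<forall>n\<in>devices sys. \<forall>s. \<exists>R. is_least_response sys s n R)"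


fun transfer_edge :: "system \<Rightarrow> stage \<Rightarrow> nat \<Rightarrow> nat \<Rightarrow> bool" where
  "transfer_edge sys Update a b \<longleftrightarrow> (a, b) \<in> edges sys"
| "transfer_edge sys Handle a b \<longleftrightarrow> (b, a) \<in> edges sys"

definition transfer_candidates ::
    "system \<Rightarrow> run \<Rightarrow> stage \<Rightarrow> nat \<Rightarrow> nat \<Rightarrow> nat \<Rightarrow> nat set" where
  "transfer_candidates sys \<rho> s a b k2 =
     {k \<in> release_indices sys a. finish_time \<rho> s a k \<le> start_time \<rho> s b k2}"

definition transfers :: "system \<Rightarrow> run \<Rightarrow> stage \<Rightarrow> nat \<Rightarrow> nat \<Rightarrow> nat \<Rightarrow> nat \<Rightarrow> bool" where
  "transfers sys \<rho> s a k1 b k2 \<longleftrightarrow>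
     transfer_edge sys s a b \<and>
     k1 \<in> transfer_candidates sys \<rho> s a b k2 \<and>
     (\<forall>k\<in>transfer_candidates sys \<rho> s a b k2. k \<le> k1)"

definition exact_indices :: "system \<Rightarrow> run \<Rightarrow> nat list \<Rightarrow> (nat \<Rightarrow> nat) \<Rightarrow> bool" where
  "exact_indices sys \<rho> xs \<kappa> \<longleftrightarrow>
     (let P = length xs in
       \<kappa> (2 * P - 1) \<in> release_indices sys (node xs 1) \<and>
       (\<forall>v\<in>{1..P - 1}.
          transfers sys \<rho> Handle (node xs (P - v + 1)) (\<kappa> (P + v - 1)) (node xs (P - v)) (\<kappa> (P + v))) \<and>
       (\<forall>u\<in>{2..P}.
          transfers sys \<rho> Update (node xs (u - 1)) (\<kappa> (u - 1)) (node xs u) (\<kappa> u)))"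

definition decision_latency :: "system \<Rightarrow> run \<Rightarrow> nat set \<Rightarrow> ereal" where
  "decision_latency sys \<rho> V =
     Sup {finish_time \<rho> Handle (node xs 1) (\<kappa> (2 * length xs - 1)) -
          start_time \<rho> Update (node xs 1) (\<kappa> 1) | xs \<kappa>.
          xs \<in> leaf_root_paths sys V \<and> exact_indices sys \<rho> xs \<kappa>}"


definition update_ordered :: "system \<Rightarrow> nat list \<Rightarrow> nat \<Rightarrow> bool" where
  "update_ordered sys xs u \<longleftrightarrow>
     (let a = node xs (u - 1); b = node xs u in
       period sys a < period sys b \<or>
       (period sys a = period sys b \<and> init_rank sys a < init_rank sys b))"

definition handle_ordered :: "system \<Rightarrow> nat list \<Rightarrow> nat \<Rightarrow> bool" where
  "handle_ordered sys xs v \<longleftrightarrow>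
     (let a = node xs (length xs - v + 1); b = node xs (length xs - v) in
       period sys a < period sys b \<or>
       (period sys a = period sys b \<and> init_rank sys a > init_rank sys b))"

text \<open>The factor \<open>period_ticks sys n\<close> is \<open>period sys n / tick sys\<close>.\<close>

definition update_step :: "system \<Rightarrow> nat list \<Rightarrow> nat \<Rightarrow> int \<Rightarrow> int" where
  "update_step sys xs u k =
     (let n = node xs (u - 1) in
       if update_ordered sys xs u
       then \<lfloor>of_int k * tick sys / period sys n\<rfloor> * int (period_ticks sys n)
       else \<lfloor>(of_int k * tick sys - response_bound sys Update n) / period sys n\<rfloor>
              * int (period_ticks sys n))"

definition handle_step :: "system \<Rightarrow> nat list \<Rightarrow> nat \<Rightarrow> int \<Rightarrow> int" where
  "handle_step sys xs v k =
     (let n = node xs (length xs - v + 1) in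
       if handle_ordered sys xs v
       then \<lfloor>of_int k * tick sys / period sys n\<rfloor> * int (period_ticks sys n)
       else \<lfloor>(of_int k * tick sys - response_bound sys Handle n) / period sys n\<rfloor>
              * int (period_ticks sys n))"

text \<open>With \<open>P = length xs\<close>, \<open>backward sys xs k i\<close> is the index \<open>k\<^sub>j\<close> for \<open>j = 2 P - 1 - i\<close>.  The step
  to \<open>k\<^bsub>j-1\<^esub>\<close> is the Handle step with \<open>v = j - P\<close> as long as \<open>j > P\<close>, and the Update step with
  \<open>u = j\<close> afterwards.\<close>

primrec backward :: "system \<Rightarrow> nat list \<Rightarrow> nat \<Rightarrow> nat \<Rightarrow> int" where
  "backward sys xs k 0 = int k"
| "backward sys xs k (Suc i) =
     (let j = 2 * length xs - 1 - i in
       if j > length xs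
       then handle_step sys xs (j - length xs) (backward sys xs k i)
       else update_step sys xs j (backward sys xs k i))"

definition backward_index :: "system \<Rightarrow> nat list \<Rightarrow> nat \<Rightarrow> nat \<Rightarrow> int" where
  "backward_index sys xs k j = backward sys xs k (2 * length xs - 1 - j)"

end

theory Submission
  imports Defs
begin

text \<open>The recurrence never overshoots the exact release indices. If the source stage of a transfer has
  priority over the target stage, every source instance released no later than the target instance
  has finished before the target starts; otherwise the source is finished once its response-time
  bound has elapsed. Hence every recursive step yields an instance available to the target, and by
  monotonicity of the steps the latest available one has at least this index.

  The response-time bound is a busy-window argument: were an instance unfinished for \<open>R\<close> time units
  after its release, the processor would spend a whole window of length \<open>R\<close> on bus responses and
  shorter-period buckets released within the window and on the stages of its own bucket up to itself,
  whose total demand is \<open>R\<close> only when the instance completes. Earlier instances of its own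
  bucket do not interfere, since they have met their deadlines.\<close>

section \<open>Counting separated points in a window\<close>

text \<open>Cut the window into cells of length \<open>T\<close>: two points in one cell would be
  closer than \<open>T\<close>, so each cell holds at most one. Half-openness matters: a closed
  window whose length is a multiple of \<open>T\<close> could hold one more point than
  \<open>R / T\<close>.\<close>

lemma separated_set_card:
  fixes S :: "real set"
  assumes S: "S \<subseteq> {a..<a + R}" and T: "T > 0" and R: "R \<ge> 0"
    and sep: "\<And>r r'. r \<in> S \<Longrightarrow> r' \<in> S \<Longrightarrow> r \<noteq> r' \<Longrightarrow> T \<le> \<bar>r - r'\<bar>"
  shows "finite S" and "real (card S) \<le> of_int \<lceil>R / T\<rceil>"
proof -
  define f where "f r = \<lfloor>(r - a) / T\<rfloor>" for r
  have inj: "inj_on f S"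
  proof (rule inj_onI, rule ccontr)
    fix x y assume x: "x \<in> S" and y: "y \<in> S" and eq: "f x = f y" and ne: "x \<noteq> y"
    have "\<bar>(x - a) / T - (y - a) / T\<bar> < 1"
      using eq unfolding f_def by linarith
    moreover have "(x - a) / T - (y - a) / T = (x - y) / T"
      by (simp add: diff_divide_distrib)
    ultimately have "\<bar>x - y\<bar> < T" using T by (simp add: abs_divide)
    with sep[OF x y ne] show False by simp
  qed
  have sub: "f ` S \<subseteq> {0..<\<lceil>R / T\<rceil>}"
  proof
    fix z assume "z \<in> f ` S"
    then obtain r where r: "r \<in> S" "z = f r" by auto
    with S have b: "a \<le> r" "r < a + R" by auto
    have "0 \<le> (r - a) / T" using b T by simp
    moreover have "(r - a) / T < R / T" using b T by (simp add: divide_strict_right_mono)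
    ultimately show "z \<in> {0..<\<lceil>R / T\<rceil>}" unfolding r(2) f_def by (auto; linarith)
  qed
  show "finite S" using inj sub by (meson finite_atLeastLessThan_int inj_on_finite)
  have "card S \<le> card {0..<\<lceil>R / T\<rceil>}" using inj sub by (intro card_inj_on_le) simp_all
  also have "real \<dots> = of_int \<lceil>R / T\<rceil>" using R T by simp
  finally show "real (card S) \<le> of_int \<lceil>R / T\<rceil>" by simp
qed

section \<open>Execution order inside a bucket\<close>

lemma occurs_before_append:
  "x \<in> set xs \<Longrightarrow> y \<in> set ys \<Longrightarrow> occurs_before (xs @ ys) x y"
  unfolding occurs_before_def in_set_conv_nth
proof (elim exE conjE)
  fix i j assume "i < length xs" "xs ! i = x" "j < length ys" "ys ! j = y"
  then show "\<exists>i j. i < j \<and> j < length (xs @ ys) \<and> (xs @ ys) ! i = x \<and> (xs @ ys) ! j = y"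
    by (intro exI[of _ i] exI[of _ "length xs + j"]) (auto simp: nth_append)
qed

lemma occurs_before_appendI1:
  "occurs_before xs x y \<Longrightarrow> occurs_before (xs @ ys) x y"
  unfolding occurs_before_def
proof (elim exE conjE)
  fix i j assume "i < j" "j < length xs" "xs ! i = x" "xs ! j = y"
  then show "\<exists>i j. i < j \<and> j < length (xs @ ys) \<and> (xs @ ys) ! i = x \<and> (xs @ ys) ! j = y"
    by (intro exI[of _ i] exI[of _ j]) (auto simp: nth_append)
qed

lemma occurs_before_appendI2:
  "occurs_before ys x y \<Longrightarrow> occurs_before (xs @ ys) x y"
  unfolding occurs_before_def
proof (elim exE conjE)
  fix i j assume "i < j" "j < length ys" "ys ! i = x" "ys ! j = y"
  then show "\<exists>i j. i < j \<and> j < length (xs @ ys) \<and> (xs @ ys) ! i = x \<and> (xs @ ys) ! j = y"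
    by (intro exI[of _ "length xs + i"] exI[of _ "length xs + j"]) (auto simp: nth_append)
qed

lemma occurs_before_map:
  "occurs_before xs x y \<Longrightarrow> occurs_before (map f xs) (f x) (f y)"
  unfolding occurs_before_def by (metis length_map nth_map order.strict_trans)

lemma occurs_before_rev:
  "occurs_before xs x y \<Longrightarrow> occurs_before (rev xs) y x"
  unfolding occurs_before_def
proof (elim exE conjE)
  fix i j assume "i < j" "j < length xs" "xs ! i = x" "xs ! j = y"
  then show "\<exists>i j. i < j \<and> j < length (rev xs) \<and> rev xs ! i = y \<and> rev xs ! j = x"
    by (intro exI[of _ "length xs - Suc j"] exI[of _ "length xs - Suc i"]) (auto simp: rev_nth)
qed

lemma occurs_before_sorted:
  fixes f :: "'a \<Rightarrow> 'b::linorder"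
  assumes "sorted (map f xs)" "x \<in> set xs" "y \<in> set xs" "f x < f y"
  shows "occurs_before xs x y"
proof -
  obtain i j where ij: "i < length xs" "xs ! i = x" "j < length xs" "xs ! j = y"
    using assms(2,3) by (auto simp: in_set_conv_nth)
  have "\<not> j \<le> i"
    using sorted_nth_mono[OF assms(1), of j i] ij assms(4) by auto
  then show ?thesis using ij unfolding occurs_before_def by (metis not_le)
qed

lemma set_bucket: "set (bucket sys T) = {n \<in> devices sys. period sys n = T}"
  by (auto simp: bucket_def devices_def)

lemma bucket_program_Update_Handle:
  assumes "a \<in> devices sys" "b \<in> devices sys" "period sys a = T" "period sys b = T"
  shows "occurs_before (bucket_program sys T) (Update, a) (Handle, b)"
  unfolding bucket_program_def
  by (rule occurs_before_append) (use assms in \<open>auto simp: set_bucket\<close>)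

lemma bucket_program_Update:
  assumes "a \<in> devices sys" "b \<in> devices sys" "period sys a = T" "period sys b = T"
    and "init_rank sys a < init_rank sys b"
  shows "occurs_before (bucket_program sys T) (Update, a) (Update, b)"
proof -
  have "occurs_before (bucket sys T) a b"
    by (rule occurs_before_sorted[where f = "init_rank sys"])
       (use assms in \<open>auto simp: set_bucket\<close>, simp add: bucket_def)
  then show ?thesis
    unfolding bucket_program_def
    by (intro occurs_before_appendI1 occurs_before_map[where f = "Pair Update"])
qed

lemma bucket_program_Handle:
  assumes "a \<in> devices sys" "b \<in> devices sys" "period sys a = T" "period sys b = T"
    and "init_rank sys a > init_rank sys b"
  shows "occurs_before (bucket_program sys T) (Handle, a) (Handle, b)"
proof -
  have "occurs_before (bucket sys T) b a"
    by (rule occurs_before_sorted[where f = "init_rank sys"])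
       (use assms in \<open>auto simp: set_bucket\<close>, simp add: bucket_def)
  then show ?thesis
    unfolding bucket_program_def
    by (intro occurs_before_appendI2 occurs_before_map[where f = "Pair Handle"] occurs_before_rev)
qed

section \<open>Releases, jobs and the scheduling policy\<close>

locale static_run =
  fixes sys :: system and \<rho> :: run
  assumes wf: "wf_system sys"
    and responses: "response_bounds_exist sys"
    and workload: "wf_workload sys \<rho>"
    and policy: "static_policy sys \<rho>"
    and deadlines: "deadlines_met sys \<rho>"
begin

lemma tick_pos: "tick sys > 0"
  using wf by (simp add: wf_system_def)

lemma period_ticks_pos: "n \<in> devices sys \<Longrightarrow> period_ticks sys n > 0"
  using wf by (simp add: wf_system_def)

lemma period_pos: "n \<in> devices sys \<Longrightarrow> period sys n > 0"
  by (simp add: period_def tick_pos period_ticks_pos)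

lemma wcet_pos: "n \<in> devices sys \<Longrightarrow> wcet sys s n > 0"
  using wf by (simp add: wf_system_def)

lemma init_rank_inj:
  "a \<in> devices sys \<Longrightarrow> b \<in> devices sys \<Longrightarrow> init_rank sys a = init_rank sys b \<Longrightarrow> a = b"
  using wf by (auto simp: wf_system_def bij_betw_def dest: inj_onD)

lemma release_indices_iff:
  "k \<in> release_indices sys n \<longleftrightarrow> period_ticks sys n dvd k"
proof -
  have "(real k * tick sys = real \<alpha> * period sys n) \<longleftrightarrow> k = \<alpha> * period_ticks sys n" for \<alpha>
  proof -
    have "(real k * tick sys = real \<alpha> * period sys n) \<longleftrightarrow>
        real k = real (\<alpha> * period_ticks sys n)"
      using tick_pos by (simp add: period_def)
    then show ?thesis by (simp only: of_nat_eq_iff)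
  qed
  then show ?thesis by (auto simp: release_indices_def dvd_def mult.commute)
qed

text \<open>Together with \<open>release_indices_iff\<close> this shows that all devices of one
  bucket share their release indices.\<close>

lemma period_ticks_eq: "period sys a = period sys b \<longleftrightarrow> period_ticks sys a = period_ticks sys b"
  using tick_pos by (simp add: period_def)

lemma release_gap:
  assumes "k \<in> release_indices sys n" "k' \<in> release_indices sys n" "k < k'"
  shows "real k * tick sys + period sys n \<le> real k' * tick sys"
proof -
  have "period_ticks sys n dvd k' - k"
    using assms by (simp add: release_indices_iff)
  then have "period_ticks sys n \<le> k' - k" using assms(3) by (simp add: dvd_imp_le)
  then have "k + period_ticks sys n \<le> k'" using assms(3) by simp
  then have "real k + real (period_ticks sys n) \<le> real k'" by linarith
  then have "(real k + real (period_ticks sys n)) * tick sys \<le> real k' * tick sys"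
    using tick_pos by (intro mult_right_mono) auto
  then show ?thesis by (simp add: period_def algebra_simps)
qed

lemma Stage_in_jobs:
  "Stage s n k \<in> jobs sys \<rho> \<longleftrightarrow> n \<in> devices sys \<and> k \<in> release_indices sys n"
  by (auto simp: jobs_def)

lemma Bus_in_jobs:
  "Bus \<beta> r \<in> jobs sys \<rho> \<longleftrightarrow> \<beta> \<in> buses sys \<and> r \<in> bus_releases \<rho> \<beta>"
  by (auto simp: jobs_def)

lemma release_time_nonneg: "j \<in> jobs sys \<rho> \<Longrightarrow> 0 \<le> release_time sys j"
  using workload tick_pos by (cases j) (auto simp: wf_workload_def Bus_in_jobs)

lemma exec_time_nonneg: "j \<in> jobs sys \<rho> \<Longrightarrow> 0 \<le> exec_time \<rho> j"
  using workload by (simp add: wf_workload_def)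

lemma exec_time_le: "j \<in> jobs sys \<rho> \<Longrightarrow> exec_time \<rho> j \<le> job_wcet sys j"
  using workload by (simp add: wf_workload_def)

lemma policyD:
  assumes "0 \<le> t"
  shows "case sched \<rho> t of
      None \<Rightarrow> (\<nexists>j. pending sys \<rho> j t)
    | Some j \<Rightarrow> pending sys \<rho> j t \<and> (\<nexists>j'. pending sys \<rho> j' t \<and> has_priority sys j' j)"
  using policy assms unfolding static_policy_def by blast

lemma running_pending:
  "0 \<le> t \<Longrightarrow> sched \<rho> t = Some j \<Longrightarrow> pending sys \<rho> j t"
  using policyD[of t] by simp

lemma no_higher_pending:
  "0 \<le> t \<Longrightarrow> sched \<rho> t = Some j \<Longrightarrow> pending sys \<rho> j' t \<Longrightarrow> \<not> has_priority sys j' j"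
  using policyD[of t] by simp

lemma pending_busy:
  "0 \<le> t \<Longrightarrow> pending sys \<rho> j t \<Longrightarrow> \<exists>j'. sched \<rho> t = Some j'"
  using policyD[of t] by (cases "sched \<rho> t") auto

section \<open>Service received by a job\<close>

lemma occupied_lmeasurable:
  assumes "A \<in> lmeasurable"
  shows "occupied \<rho> j \<inter> A \<in> lmeasurable"
  using policy assms
  by (metis fmeasurable_Int_fmeasurable inf_commute static_policy_def)

lemma service_mono: "s \<le> t \<Longrightarrow> service \<rho> j s \<le> service \<rho> j t"
  unfolding service_def
  by (rule measure_mono_fmeasurable) (auto intro: fmeasurableD occupied_lmeasurable)

text \<open>The processor serves at unit rate. With monotonicity this makes service 1-Lipschitz in
  time, hence continuous.\<close>

lemma service_increment:
  assumes "s \<le> t"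
  shows "service \<rho> j t \<le> service \<rho> j s + (t - s)"
proof -
  have "service \<rho> j t \<le> measure lebesgue (occupied \<rho> j \<inter> {0..s} \<union> occupied \<rho> j \<inter> {s..t})"
    unfolding service_def
    by (rule measure_mono_fmeasurable)
       (auto intro!: fmeasurableD occupied_lmeasurable fmeasurable.Un)
  also have "\<dots> \<le> service \<rho> j s + measure lebesgue (occupied \<rho> j \<inter> {s..t})"
    unfolding service_def by (intro measure_Un_le fmeasurableD occupied_lmeasurable) auto
  also have "measure lebesgue (occupied \<rho> j \<inter> {s..t}) \<le> measure lebesgue {s..t}"
    by (rule measure_mono_fmeasurable) (auto intro: fmeasurableD occupied_lmeasurable)
  also have "measure lebesgue {s..t} = t - s" using assms by simp
  finally show ?thesis by simp
qed

lemma continuous_on_service: "continuous_on A (service \<rho> j)"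
proof (rule lipschitz_on_continuous_on[OF lipschitz_onI])
  fix x y
  show "dist (service \<rho> j x) (service \<rho> j y) \<le> 1 * dist x y"
    using service_mono[of x y j] service_mono[of y x j]
      service_increment[of x y j] service_increment[of y x j]
    by (cases "x \<le> y") (auto simp: dist_real_def)
qed simp

text \<open>The policy only says that a running job is pending. By continuity, an excess of service
  would require a time \<open>s\<close> at which service equals the execution time; from then on the
  job is no longer pending, never runs again, and its service stays constant.\<close>

lemma service_le_exec_time:
  assumes "j \<in> jobs sys \<rho>" "0 \<le> t"
  shows "service \<rho> j t \<le> exec_time \<rho> j"
proof (rule ccontr)
  assume less: "\<not> ?thesis"
  \<comment> \<open>A single point has measure zero, which gives the lower end for the intermediate
    value theorem.\<close>
  have "service \<rho> j 0 \<le> measure lebesgue {0::real..0}"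
    unfolding service_def
    by (intro measure_mono_fmeasurable fmeasurableD occupied_lmeasurable lmeasurable_interval
        Int_lower2)
  then have "service \<rho> j 0 \<le> exec_time \<rho> j" using exec_time_nonneg[OF assms(1)] by simp
  then obtain s where s: "0 \<le> s" "s \<le> t" "service \<rho> j s = exec_time \<rho> j"
    using IVT'[of "service \<rho> j" 0 "exec_time \<rho> j" t] less assms(2) continuous_on_service
    by auto
  have "u \<le> s" if "u \<in> occupied \<rho> j" for u
  proof (rule ccontr)
    assume "\<not> u \<le> s"
    then have "exec_time \<rho> j \<le> service \<rho> j u" using s service_mono[of s u j] by simp
    moreover have "service \<rho> j u < exec_time \<rho> j"
      using that running_pending by (auto simp: occupied_def pending_def)
    ultimately show False by simp
  qed
  then have "service \<rho> j t \<le> service \<rho> j s"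
    unfolding service_def
    by (intro measure_mono_fmeasurable) (auto intro: fmeasurableD occupied_lmeasurable)
  with s less show False by simp
qed

section \<open>Finish times, priorities and deadlines\<close>

lemma finish_time_le:
  "0 \<le> t \<Longrightarrow> exec_time \<rho> (Stage s n k) \<le> service \<rho> (Stage s n k) t \<Longrightarrow>
    finish_time \<rho> s n k \<le> ereal t"
  unfolding finish_time_def by (rule INF_lower) simp

text \<open>The infimum defining the finish time is attained: some time before \<open>t + e\<close>
  has full service, and the extra \<open>e\<close> contributes at most \<open>e\<close> because
  service is 1-Lipschitz.\<close>

lemma finished:
  assumes "finish_time \<rho> s n k \<le> ereal t"
  shows "exec_time \<rho> (Stage s n k) \<le> service \<rho> (Stage s n k) t"
proof (rule field_le_epsilon)
  fix e :: real assume e: "e > 0"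
  have "finish_time \<rho> s n k < ereal (t + e)"
    by (rule le_less_trans[OF assms]) (use e in simp)
  then obtain u where u: "exec_time \<rho> (Stage s n k) \<le> service \<rho> (Stage s n k) u" "u < t + e"
    unfolding finish_time_def INF_less_iff by auto
  have "service \<rho> (Stage s n k) u \<le> service \<rho> (Stage s n k) (t + e)"
    using u by (intro service_mono) simp
  also have "\<dots> \<le> service \<rho> (Stage s n k) t + e"
    using service_increment[of t "t + e" "Stage s n k"] e by simp
  finally show "exec_time \<rho> (Stage s n k) \<le> service \<rho> (Stage s n k) t + e" using u by simp
qed

lemma higher_priority_done:
  assumes "0 \<le> t" "sched \<rho> t = Some j'" "has_priority sys j j'"
    and "j \<in> jobs sys \<rho>" "release_time sys j \<le> t"
  shows "exec_time \<rho> j \<le> service \<rho> j t"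
  using no_higher_pending[OF assms(1,2), of j] assms(3-5)
  by (cases "service \<rho> j t < exec_time \<rho> j") (auto simp: pending_def)

text \<open>\<open>deadlines_met\<close> speaks of Handle stages only. For an Update, use that the
  Handle of the same release needs positive execution, so it runs at some moment up to
  \<open>t\<close>; by then the Update, which precedes it in the bucket program, must be
  done.\<close>

lemma done_by_deadline:
  assumes n: "n \<in> devices sys" and k: "k \<in> release_indices sys n"
    and t: "real k * tick sys + period sys n \<le> t"
  shows "exec_time \<rho> (Stage s n k) \<le> service \<rho> (Stage s n k) t"
proof -
  have "finish_time \<rho> Handle n k \<le> ereal t"
    using deadlines n k t unfolding deadlines_met_def by (meson ereal_less_eq(3) order_trans)
  then have H: "exec_time \<rho> (Stage Handle n k) \<le> service \<rho> (Stage Handle n k) t"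
    by (rule finished)
  show ?thesis
  proof (cases s)
    case Handle
    with H show ?thesis by simp
  next
    case Update
    have "0 < exec_time \<rho> (Stage Handle n k)"
      using workload n k by (auto simp: wf_workload_def Stage_in_jobs)
    with H have "measure lebesgue (occupied \<rho> (Stage Handle n k) \<inter> {0..t}) > 0"
      by (simp add: service_def)
    then have "occupied \<rho> (Stage Handle n k) \<inter> {0..t} \<noteq> {}" by (metis measure_empty less_irrefl)
    then obtain u where u: "0 \<le> u" "u \<le> t" "sched \<rho> u = Some (Stage Handle n k)"
      by (auto simp: occupied_def)
    have "real k * tick sys \<le> u"
      using running_pending[OF u(1,3)] by (simp add: pending_def)
    then have "exec_time \<rho> (Stage Update n k) \<le> service \<rho> (Stage Update n k) u"
      using u n k
      by (intro higher_priority_done) (auto simp: Stage_in_jobs bucket_program_Update_Handle)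
    also have "\<dots> \<le> service \<rho> (Stage Update n k) t" using u by (intro service_mono)
    finally show ?thesis using Update by simp
  qed
qed

section \<open>Interference from above a bucket, and busy windows\<close>

definition interfering :: "real \<Rightarrow> job set" where
  "interfering T =
     {j \<in> jobs sys \<rho>. case j of Bus _ _ \<Rightarrow> True | Stage _ n _ \<Rightarrow> period sys n < T}"

text \<open>Consequently, whenever an interfering job is pending, the running job is itself
  interfering.\<close>

lemma interfering_has_priority:
  assumes "j \<in> interfering T" "j' \<in> jobs sys \<rho>" "j' \<notin> interfering T"
  shows "has_priority sys j j'"
  using assms by (cases j; cases j') (auto simp: interfering_def)

text \<open>The start of the busy window may precede the release at \<open>t0\<close>, so that no work released
  earlier is carried into it.\<close>

lemma busy_window:
  assumes "0 \<le> t0"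
  obtains tb where "0 \<le> tb" "tb \<le> t0"
    and "\<And>j. j \<in> interfering T \<Longrightarrow> release_time sys j < tb \<Longrightarrow> exec_time \<rho> j \<le> service \<rho> j tb"
    and "\<And>t. tb < t \<Longrightarrow> t \<le> t0 \<Longrightarrow> \<exists>j\<in>interfering T. pending sys \<rho> j t"
proof -
  \<comment> \<open>\<open>A\<close> consists of the times at which all interfering work released
    earlier is complete. It contains 0 because no release time is negative; the busy window begins
    at its supremum.\<close>
  define A where "A = {t. 0 \<le> t \<and> t \<le> t0 \<and>
    (\<forall>j\<in>interfering T. release_time sys j < t \<longrightarrow> exec_time \<rho> j \<le> service \<rho> j t)}"
  define tb where "tb = Sup A"
  have "0 \<in> A"
    using assms release_time_nonneg by (force simp: A_def interfering_def)
  have bdd: "bdd_above A" by (rule bdd_aboveI[of _ t0]) (simp add: A_def)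
  have "0 \<le> tb" unfolding tb_def using \<open>0 \<in> A\<close> bdd by (rule cSup_upper)
  moreover have "tb \<le> t0"
    unfolding tb_def using \<open>0 \<in> A\<close> by (intro cSup_least) (auto simp: A_def)
  moreover have "exec_time \<rho> j \<le> service \<rho> j tb"
    if j: "j \<in> interfering T" and rel: "release_time sys j < tb" for j
  proof -
    \<comment> \<open>The comparison of release times is strict, so a release below the supremum is
      already below some member of \<open>A\<close>. This is why the supremum inherits the
      property.\<close>
    obtain t where t: "t \<in> A" "release_time sys j < t"
      using rel \<open>0 \<in> A\<close> bdd unfolding tb_def by (metis empty_iff less_cSup_iff)
    then have "exec_time \<rho> j \<le> service \<rho> j t" using j by (auto simp: A_def)
    also have "\<dots> \<le> service \<rho> j tb"
      unfolding tb_def by (intro service_mono cSup_upper t bdd)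
    finally show ?thesis .
  qed
  moreover have "\<exists>j\<in>interfering T. pending sys \<rho> j t" if "tb < t" "t \<le> t0" for t
  proof -
    have "t \<notin> A" using that bdd unfolding tb_def by (meson cSup_upper not_le)
    then show ?thesis
      using that \<open>0 \<le> tb\<close> by (force simp: A_def pending_def interfering_def)
  qed
  ultimately show thesis by (rule that)
qed

section \<open>Response-time fixed points and the demand of the own bucket\<close>

lemma response_bound_fixed_point:
  assumes "n \<in> devices sys"
  shows "0 \<le> response_bound sys s n"
    and "response_bound sys s n = demand sys s n (response_bound sys s n)"
proof -
  obtain R where R: "is_least_response sys s n R"
    using responses assms by (auto simp: response_bounds_exist_def)
  have "is_least_response sys s n (response_bound sys s n)"
    unfolding response_bound_def
  proof (rule theI[where P = "is_least_response sys s n", OF R])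
    fix R' assume "is_least_response sys s n R'"
    with R show "R' = R" unfolding is_least_response_def by (meson antisym)
  qed
  then show "0 \<le> response_bound sys s n"
    and "response_bound sys s n = demand sys s n (response_bound sys s n)"
    by (auto simp: is_least_response_def)
qed

text \<open>The stages of the bucket of \<open>n\<close> up to and including \<open>(s, n)\<close> in execution order.\<close>

definition own_stages :: "stage \<Rightarrow> nat \<Rightarrow> (stage \<times> nat) set" where
  "own_stages s n =
     {(s', u). u \<in> devices sys \<and> period sys u = period sys n \<and>
        (case s of Update \<Rightarrow> s' = Update \<and> init_rank sys u \<le> init_rank sys n
         | Handle \<Rightarrow> s' = Update \<or> init_rank sys n \<le> init_rank sys u)}"

lemma finite_stage: "finite (A :: stage set)"
proof -
  have "A \<subseteq> {Update, Handle}" using stage.exhaust by auto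
  then show ?thesis by (rule finite_subset) simp
qed

lemma finite_devices: "finite (devices sys)"
  by (simp add: devices_def)

lemma finite_own_stages: "finite (own_stages s n)"
proof (rule finite_subset)
  show "own_stages s n \<subseteq> UNIV \<times> devices sys" by (auto simp: own_stages_def)
  show "finite (UNIV \<times> devices sys :: (stage \<times> nat) set)"
    by (intro finite_cartesian_product finite_stage finite_devices)
qed

lemma self_in_own_stages: "n \<in> devices sys \<Longrightarrow> (s, n) \<in> own_stages s n"
  by (auto simp: own_stages_def split: stage.split)

text \<open>Since ranks are injective, the non-strict rank comparison in \<open>own_stages\<close>
  splits into the strict one of \<open>own_demand\<close> and the single device
  \<open>n\<close>.\<close>

lemma sum_own_stages:
  assumes n: "n \<in> devices sys"
  shows "(\<Sum>(s', u)\<in>own_stages s n. wcet sys s' u) = own_demand sys s n"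
proof (cases s)
  case Update
  let ?L = "{u \<in> devices sys. period sys u = period sys n \<and> init_rank sys u < init_rank sys n}"
  have eq: "own_stages s n = Pair Update ` insert n ?L"
    using Update n init_rank_inj by (force simp: own_stages_def le_less)
  have "(\<Sum>(s', u)\<in>own_stages s n. wcet sys s' u) = (\<Sum>u\<in>insert n ?L. wcet sys Update u)"
    unfolding eq by (subst sum.reindex) (auto simp: inj_on_def)
  then show ?thesis
    using Update finite_devices by simp
next
  case Handle
  let ?B = "{u \<in> devices sys. period sys u = period sys n}"
  let ?G = "{u \<in> devices sys. period sys u = period sys n \<and> init_rank sys u > init_rank sys n}"
  have "(s', u) \<in> own_stages s n \<longleftrightarrow> (s', u) \<in> Pair Update ` ?B \<union> Pair Handle ` insert n ?G"
    for s' u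
    using Handle n by (cases s') (auto simp: own_stages_def le_less dest: init_rank_inj[OF n])
  then have eq: "own_stages s n = Pair Update ` ?B \<union> Pair Handle ` insert n ?G" by auto
  have "(\<Sum>(s', u)\<in>own_stages s n. wcet sys s' u) =
      (\<Sum>(s', u)\<in>Pair Update ` ?B. wcet sys s' u) +
      (\<Sum>(s', u)\<in>Pair Handle ` insert n ?G. wcet sys s' u)"
    unfolding eq using finite_devices by (intro sum.union_disjoint) auto
  also have "(\<Sum>(s', u)\<in>Pair Update ` ?B. wcet sys s' u) = (\<Sum>u\<in>?B. wcet sys Update u)"
    by (subst sum.reindex) (auto simp: inj_on_def)
  also have "(\<Sum>(s', u)\<in>Pair Handle ` insert n ?G. wcet sys s' u) =
      (\<Sum>u\<in>insert n ?G. wcet sys Handle u)"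
    by (subst sum.reindex) (auto simp: inj_on_def)
  finally show ?thesis
    using Handle finite_devices by simp
qed

text \<open>Used in contrapositive form: a stage of the same bucket and release index that runs
  while \<open>(s, n)\<close> is pending must lie in \<open>own_stages s n\<close>.\<close>

lemma own_stages_precede:
  assumes "n \<in> devices sys" "u \<in> devices sys" "period sys u = period sys n"
    and "(s', u) \<notin> own_stages s n"
  shows "occurs_before (bucket_program sys (period sys n)) (s, n) (s', u)"
  using assms
  by (cases s; cases s')
     (auto simp: own_stages_def not_le
       intro: bucket_program_Update_Handle bucket_program_Update bucket_program_Handle)

text \<open>An unfinished released instance is pending, so the running job is not below it. Since
  \<open>has_priority\<close> leaves different releases of one bucket unordered, these are excluded
  through the deadlines.\<close>

lemma bucket_or_interference_runs:
  assumes n: "n \<in> devices sys" and k: "k \<in> release_indices sys n"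
    and t: "real k * tick sys \<le> t"
    and unfinished: "service \<rho> (Stage s n k) t < exec_time \<rho> (Stage s n k)"
  obtains j where "sched \<rho> t = Some j"
    and "j \<in> interfering (period sys n) \<union> (\<lambda>(s', u). Stage s' u k) ` own_stages s n"
proof -
  have t0: "0 \<le> t" using t tick_pos by (meson order_trans less_imp_le mult_nonneg_nonneg of_nat_0_le_iff)
  have pend: "pending sys \<rho> (Stage s n k) t"
    using n k t unfinished by (simp add: pending_def Stage_in_jobs)
  obtain j where j: "sched \<rho> t = Some j" using pending_busy[OF t0 pend] by blast
  have jp: "pending sys \<rho> j t" using running_pending[OF t0 j] .
  have nprio: "\<not> has_priority sys (Stage s n k) j" using no_higher_pending[OF t0 j pend] .
  have "j \<in> interfering (period sys n) \<union> (\<lambda>(s', u). Stage s' u k) ` own_stages s n"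
  proof (cases j)
    case (Bus \<beta> r)
    with jp show ?thesis by (simp add: pending_def interfering_def)
  next
    case (Stage s' u k')
    have u: "u \<in> devices sys" and k': "k' \<in> release_indices sys u"
      and rel: "real k' * tick sys \<le> t"
      and unf: "service \<rho> (Stage s' u k') t < exec_time \<rho> (Stage s' u k')"
      using jp Stage by (auto simp: pending_def Stage_in_jobs)
    show ?thesis
    proof (cases "period sys u = period sys n")
      case False
      with nprio Stage have "period sys u < period sys n" by auto
      with jp Stage show ?thesis by (simp add: pending_def interfering_def)
    next
      case True
      then have k'n: "k' \<in> release_indices sys n"
        using k' by (simp add: release_indices_iff period_ticks_eq)
      \<comment> \<open>The deadline of an earlier release has passed by the release at
        \<open>k\<close>, so that release is finished and cannot run.\<close>
      have "\<not> k' < k"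
      proof
        assume "k' < k"
        then have "real k' * tick sys + period sys u \<le> t"
          using release_gap[OF k'n k] True t by simp
        with done_by_deadline[OF u k'] unf show False by (meson not_le)
      qed
      \<comment> \<open>A later release can run only after the deadline of release \<open>k\<close>,
        which contradicts that \<open>(s, n)\<close> is still unfinished.\<close>
      moreover have "\<not> k < k'"
      proof
        assume "k < k'"
        then have "real k * tick sys + period sys n \<le> t"
          using release_gap[OF k k'n] rel by simp
        with done_by_deadline[OF n k] unfinished show False by (meson not_le)
      qed
      ultimately have kk: "k' = k" by simp
      then have "\<not> occurs_before (bucket_program sys (period sys n)) (s, n) (s', u)"
        using nprio Stage True by simp
      then have "(s', u) \<in> own_stages s n" using own_stages_precede n u True by blast
      then show ?thesis using Stage kk by force
    qed
  qed
  with j show thesis by (rule that)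
qed

section \<open>Interference demand within a window\<close>

lemma bus_interference:
  assumes b: "\<beta> \<in> buses sys" and R: "0 \<le> R"
  shows "finite {r \<in> bus_releases \<rho> \<beta>. a \<le> r \<and> r < a + R}"
    and "real (card {r \<in> bus_releases \<rho> \<beta>. a \<le> r \<and> r < a + R}) \<le> of_int \<lceil>R / bus_period sys \<beta>\<rceil>"
proof -
  let ?S = "{r \<in> bus_releases \<rho> \<beta>. a \<le> r \<and> r < a + R}"
  have pos: "bus_period sys \<beta> > 0"
    using wf b by (auto simp: wf_system_def bus_period_def)
  have sep: "bus_period sys \<beta> \<le> \<bar>r - r'\<bar>" if "r \<in> ?S" "r' \<in> ?S" "r \<noteq> r'" for r r'
    using workload b that by (force simp: wf_workload_def bus_period_def)
  have "?S \<subseteq> {a..<a + R}" by auto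
  from separated_set_card[OF this pos R sep]
  show "finite ?S" "real (card ?S) \<le> of_int \<lceil>R / bus_period sys \<beta>\<rceil>" by auto
qed

lemma device_interference:
  fixes a :: real
  assumes u: "u \<in> devices sys" and R: "0 \<le> R"
  defines "K \<equiv> {k \<in> release_indices sys u. a \<le> real k * tick sys \<and> real k * tick sys < a + R}"
  shows "finite K" and "real (card K) \<le> of_int \<lceil>R / period sys u\<rceil>"
proof -
  let ?f = "\<lambda>k. real k * tick sys"
  have inj: "inj_on ?f K" using tick_pos by (auto intro: inj_onI)
  have sep: "period sys u \<le> \<bar>r - r'\<bar>" if r: "r \<in> ?f ` K" "r' \<in> ?f ` K" "r \<noteq> r'" for r r'
  proof -
    obtain k k' where k: "r = ?f k" "r' = ?f k'" "k \<in> release_indices sys u"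
      "k' \<in> release_indices sys u" using r(1,2) unfolding K_def by auto
    with r(3) have "k < k' \<or> k' < k" by (metis linorder_neqE_nat)
    then show ?thesis using release_gap[of k u k'] release_gap[of k' u k] k by auto
  qed
  have sub: "?f ` K \<subseteq> {a..<a + R}" by (auto simp: K_def)
  note sc = separated_set_card[OF sub period_pos[OF u] R sep]
  show "finite K" using sc(1) inj finite_imageD by blast
  show "real (card K) \<le> of_int \<lceil>R / period sys u\<rceil>"
    using sc(2) by (simp add: card_image[OF inj])
qed

text \<open>The jobs released in the window split into bus responses, Updates and Handles. Each
  source has a bounded number of releases by the counting lemma, and the bounds for the two stages
  of a device add up to its \<open>device_wcet\<close>.\<close>

lemma interference_demand:
  fixes a T :: real
  assumes R: "0 \<le> R"
  defines "I \<equiv> {j \<in> interfering T. a \<le> release_time sys j \<and> release_time sys j < a + R}"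
  shows "finite I"
    and "(\<Sum>j\<in>I. job_wcet sys j) \<le>
      (\<Sum>\<beta>\<in>buses sys. of_int \<lceil>R / bus_period sys \<beta>\<rceil> * bus_wcet sys \<beta>) +
      (\<Sum>T'\<in>{T' \<in> period sys ` devices sys. T' < T}. of_int \<lceil>R / T'\<rceil> * bucket_wcet sys T')"
proof -
  define rel where "rel \<beta> = {r \<in> bus_releases \<rho> \<beta>. a \<le> r \<and> r < a + R}" for \<beta>
  define K where "K u = {k \<in> release_indices sys u.
    a \<le> real k * tick sys \<and> real k * tick sys < a + R}" for u
  define D where "D = {u \<in> devices sys. period sys u < T}"
  define IB where "IB = (\<lambda>(\<beta>, r). Bus \<beta> r) ` (SIGMA \<beta>:buses sys. rel \<beta>)"
  define ID where "ID s = (\<lambda>(u, k). Stage s u k) ` (SIGMA u:D. K u)" for s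
  have finD: "finite D" by (simp add: D_def finite_devices)
  have finb: "finite (buses sys)" by (simp add: buses_def)
  have rel: "finite (rel \<beta>)" "real (card (rel \<beta>)) \<le> of_int \<lceil>R / bus_period sys \<beta>\<rceil>"
    if "\<beta> \<in> buses sys" for \<beta>
    using bus_interference[OF that R] by (simp_all add: rel_def)
  have K: "finite (K u)" "real (card (K u)) \<le> of_int \<lceil>R / period sys u\<rceil>" if "u \<in> D" for u
    using device_interference[OF _ R] that by (simp_all add: K_def D_def)
  have finIB: "finite IB" unfolding IB_def using finb rel by auto
  have finID: "finite (ID s)" for s unfolding ID_def using finD K by auto
  have I: "I = IB \<union> (ID Update \<union> ID Handle)" (is "_ = ?U")
  proof
    show "I \<subseteq> ?U"
    proof
      fix j assume j: "j \<in> I"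
      show "j \<in> ?U"
      proof (cases j)
        case (Bus \<beta> r)
        with j show ?thesis by (force simp: I_def IB_def rel_def interfering_def Bus_in_jobs)
      next
        case (Stage s u k)
        with j have "j \<in> ID s"
          by (force simp: I_def ID_def K_def D_def interfering_def Stage_in_jobs)
        then show ?thesis by (cases s) auto
      qed
    qed
    show "?U \<subseteq> I"
      by (auto simp: I_def IB_def ID_def rel_def K_def D_def interfering_def Bus_in_jobs
          Stage_in_jobs)
  qed
  show "finite I" using I finIB finID by simp
  have "(\<Sum>j\<in>IB. job_wcet sys j) = (\<Sum>(\<beta>, r)\<in>(SIGMA \<beta>:buses sys. rel \<beta>). bus_wcet sys \<beta>)"
    unfolding IB_def by (subst sum.reindex) (auto simp: inj_on_def intro!: sum.cong)
  also have "\<dots> = (\<Sum>\<beta>\<in>buses sys. real (card (rel \<beta>)) * bus_wcet sys \<beta>)"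
    using finb rel by (subst sum.Sigma[symmetric]) auto
  also have "\<dots> \<le> (\<Sum>\<beta>\<in>buses sys. of_int \<lceil>R / bus_period sys \<beta>\<rceil> * bus_wcet sys \<beta>)"
    using rel wf by (intro sum_mono mult_right_mono) (auto simp: wf_system_def)
  finally have B: "(\<Sum>j\<in>IB. job_wcet sys j) \<le> \<dots>" .
  have D: "(\<Sum>j\<in>ID s. job_wcet sys j) \<le> (\<Sum>u\<in>D. of_int \<lceil>R / period sys u\<rceil> * wcet sys s u)" for s
  proof -
    have "(\<Sum>j\<in>ID s. job_wcet sys j) = (\<Sum>(u, k)\<in>(SIGMA u:D. K u). wcet sys s u)"
      unfolding ID_def by (subst sum.reindex) (auto simp: inj_on_def intro!: sum.cong)
    also have "\<dots> = (\<Sum>u\<in>D. real (card (K u)) * wcet sys s u)"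
      using finD K by (subst sum.Sigma[symmetric]) auto
    also have "\<dots> \<le> (\<Sum>u\<in>D. of_int \<lceil>R / period sys u\<rceil> * wcet sys s u)"
      using K wcet_pos by (intro sum_mono mult_right_mono) (auto simp: D_def less_imp_le)
    finally show ?thesis .
  qed
  let ?T = "{T' \<in> period sys ` devices sys. T' < T}"
  have "(\<Sum>j\<in>ID Update. job_wcet sys j) + (\<Sum>j\<in>ID Handle. job_wcet sys j)
      \<le> (\<Sum>u\<in>D. of_int \<lceil>R / period sys u\<rceil> * device_wcet sys u)"
    using D[of Update] D[of Handle] by (simp add: device_wcet_def distrib_left sum.distrib)
  \<comment> \<open>The fixed-point equation sums over distinct periods, so the devices are grouped
    by period.\<close>
  also have "\<dots> = (\<Sum>T'\<in>?T. \<Sum>u\<in>{u \<in> D. period sys u = T'}.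
      of_int \<lceil>R / period sys u\<rceil> * device_wcet sys u)"
    using finD finite_devices by (intro sum.group[symmetric]) (auto simp: D_def)
  also have "\<dots> = (\<Sum>T'\<in>?T. of_int \<lceil>R / T'\<rceil> * bucket_wcet sys T')"
  proof (rule sum.cong[OF refl])
    fix T' assume "T' \<in> ?T"
    then have "{u \<in> D. period sys u = T'} = set (bucket sys T')"
      by (auto simp: D_def set_bucket)
    then show "(\<Sum>u\<in>{u \<in> D. period sys u = T'}. of_int \<lceil>R / period sys u\<rceil> * device_wcet sys u) =
        of_int \<lceil>R / T'\<rceil> * bucket_wcet sys T'"
      by (simp add: bucket_wcet_def sum_distrib_left set_bucket)
  qed
  finally have D': "(\<Sum>j\<in>ID Update. job_wcet sys j) + (\<Sum>j\<in>ID Handle. job_wcet sys j) \<le> \<dots>" .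
  have "(\<Sum>j\<in>I. job_wcet sys j) =
      (\<Sum>j\<in>IB. job_wcet sys j) + (\<Sum>j\<in>ID Update \<union> ID Handle. job_wcet sys j)"
    unfolding I using finIB finID by (intro sum.union_disjoint) (auto simp: IB_def ID_def)
  also have "(\<Sum>j\<in>ID Update \<union> ID Handle. job_wcet sys j) =
      (\<Sum>j\<in>ID Update. job_wcet sys j) + (\<Sum>j\<in>ID Handle. job_wcet sys j)"
    using finID by (intro sum.union_disjoint) (auto simp: ID_def)
  finally show "(\<Sum>j\<in>I. job_wcet sys j) \<le>
      (\<Sum>\<beta>\<in>buses sys. of_int \<lceil>R / bus_period sys \<beta>\<rceil> * bus_wcet sys \<beta>) +
      (\<Sum>T'\<in>?T. of_int \<lceil>R / T'\<rceil> * bucket_wcet sys T')"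
    using B D' by linarith
qed

section \<open>The response-time bound\<close>

lemma finish_time_le_response_bound:
  assumes n: "n \<in> devices sys" and k: "k \<in> release_indices sys n"
  shows "finish_time \<rho> s n k \<le> ereal (real k * tick sys + response_bound sys s n)"
proof -
  define t0 where "t0 = real k * tick sys"
  define R where "R = response_bound sys s n"
  let ?J = "Stage s n k"
  let ?T = "period sys n"
  have R: "0 \<le> R" "R = demand sys s n R"
    using response_bound_fixed_point[OF n] by (simp_all add: R_def)
  have t0: "0 \<le> t0" using tick_pos by (simp add: t0_def)
  have Jjob: "?J \<in> jobs sys \<rho>" using n k by (simp add: Stage_in_jobs)
  have "exec_time \<rho> ?J \<le> service \<rho> ?J (t0 + R)"
  proof (rule ccontr)
    assume unfinished: "\<not> ?thesis"
    obtain tb where tb: "0 \<le> tb" "tb \<le> t0"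
      and clean: "\<And>j. j \<in> interfering ?T \<Longrightarrow> release_time sys j < tb \<Longrightarrow>
        exec_time \<rho> j \<le> service \<rho> j tb"
      and busy: "\<And>t. tb < t \<Longrightarrow> t \<le> t0 \<Longrightarrow> \<exists>j\<in>interfering ?T. pending sys \<rho> j t"
      using busy_window[OF t0] by blast
    \<comment> \<open>The window of length \<open>R\<close> begins at \<open>tb\<close> instead of
      \<open>t0\<close>. As \<open>tb \<le> t0\<close>, it ends no later than \<open>t0 + R\<close>,
      so the instance is still unfinished at its end.\<close>
    have unf: "service \<rho> ?J t < exec_time \<rho> ?J" if "t \<le> tb + R" for t
      using service_mono[of t "t0 + R" ?J] that tb unfinished by simp
    \<comment> \<open>The left end is open since \<open>busy\<close> speaks only of times after
      \<open>tb\<close>; the right end is open so that every job running in \<open>W\<close> is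
      released strictly before \<open>tb + R\<close>, as the counting requires.\<close>
    define W where "W = {tb<..<tb + R}"
    define I where
      "I = {j \<in> interfering ?T. tb \<le> release_time sys j \<and> release_time sys j < tb + R}"
    define Own where "Own = (\<lambda>(s', u). Stage s' u k) ` own_stages s n"
    have inj: "inj_on (\<lambda>(s', u). Stage s' u k) (own_stages s n)" by (auto simp: inj_on_def)
    have finI: "finite I"
      and I_le: "(\<Sum>j\<in>I. job_wcet sys j) \<le>
      (\<Sum>\<beta>\<in>buses sys. of_int \<lceil>R / bus_period sys \<beta>\<rceil> * bus_wcet sys \<beta>) +
      (\<Sum>T'\<in>{T' \<in> period sys ` devices sys. T' < ?T}. of_int \<lceil>R / T'\<rceil> * bucket_wcet sys T')"
      unfolding I_def using interference_demand[OF R(1)] by blast+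
    have finOwn: "finite Own" by (simp add: Own_def finite_own_stages)
    have JOwn: "?J \<in> Own" using self_in_own_stages[OF n, of s] by (force simp: Own_def)
    have Own_jobs: "j \<in> jobs sys \<rho>" if "j \<in> Own" for j
      using that k
      by (auto simp: Own_def own_stages_def Stage_in_jobs release_indices_iff period_ticks_eq)
    have I_jobs: "j \<in> jobs sys \<rho>" if "j \<in> I" for j
      using that by (simp add: I_def interfering_def)
    have disj: "I \<inter> Own = {}"
      by (auto simp: I_def Own_def own_stages_def interfering_def)
    \<comment> \<open>Before \<open>t0\<close> an interfering job is pending, so an interfering job
      runs; from \<open>t0\<close> on, the unfinished instance itself keeps the processor on
      interference or its own bucket. By \<open>clean\<close>, interfering jobs running here were
      not released before \<open>tb\<close>.\<close>
    have cover: "W \<subseteq> (\<Union>j\<in>I \<union> Own. occupied \<rho> j \<inter> W)"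
    proof
      fix t assume t: "t \<in> W"
      then have t': "tb < t" "t < tb + R" "0 \<le> t" using tb by (auto simp: W_def)
      obtain j where j: "sched \<rho> t = Some j" "j \<in> interfering ?T \<union> Own"
      proof (cases "t0 \<le> t")
        case True
        then show thesis
          using bucket_or_interference_runs[OF n k _ unf[of t]] t' that
          unfolding t0_def Own_def by (metis less_imp_le)
      next
        case False
        then obtain i where i: "i \<in> interfering ?T" "pending sys \<rho> i t"
          using busy t' by (meson le_cases)
        obtain j where j: "sched \<rho> t = Some j" using pending_busy[OF t'(3) i(2)] by blast
        have "j \<in> jobs sys \<rho>" using running_pending[OF t'(3) j] by (simp add: pending_def)
        then have "j \<in> interfering ?T"
          using interfering_has_priority[OF i(1)] no_higher_pending[OF t'(3) j i(2)] by blast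
        then show thesis using j that by blast
      qed
      have jp: "pending sys \<rho> j t" using running_pending[OF t'(3) j(1)] .
      have "j \<in> I" if ji: "j \<in> interfering ?T"
      proof -
        have "\<not> release_time sys j < tb"
        proof
          assume "release_time sys j < tb"
          then have "exec_time \<rho> j \<le> service \<rho> j t"
            using clean[OF ji] service_mono[of tb t j] t' by simp
          with jp show False by (simp add: pending_def)
        qed
        then show ?thesis using ji jp t' by (simp add: I_def pending_def)
      qed
      then show "t \<in> (\<Union>j\<in>I \<union> Own. occupied \<rho> j \<inter> W)"
        using j t t' by (auto simp: occupied_def)
    qed
    have W: "W \<in> lmeasurable" by (simp add: W_def)
    have "R = measure lebesgue W" using R by (simp add: W_def)
    also have "\<dots> \<le> measure lebesgue (\<Union>j\<in>I \<union> Own. occupied \<rho> j \<inter> W)"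
      using cover finI finOwn W
      by (intro measure_mono_fmeasurable fmeasurable.finite_UN fmeasurableD occupied_lmeasurable) auto
    also have "\<dots> \<le> (\<Sum>j\<in>I \<union> Own. measure lebesgue (occupied \<rho> j \<inter> W))"
      using finI finOwn W by (intro measure_UNION_le fmeasurableD occupied_lmeasurable) auto
    also have "\<dots> \<le> (\<Sum>j\<in>I \<union> Own. service \<rho> j (tb + R))"
      unfolding service_def using W tb
      by (intro sum_mono measure_mono_fmeasurable fmeasurableD occupied_lmeasurable
          lmeasurable_interval) (auto simp: W_def)
    also have "\<dots> = (\<Sum>j\<in>I. service \<rho> j (tb + R)) + (\<Sum>j\<in>Own. service \<rho> j (tb + R))"
      using finI finOwn disj by (rule sum.union_disjoint)
    \<comment> \<open>Strictness comes from the instance under study: its service at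
      \<open>tb + R\<close> is still below its execution time, hence below its WCET. The chain thus
      ends in \<open>R < demand sys s n R\<close>, against the fixed-point equation.\<close>
    also have "\<dots> < (\<Sum>j\<in>I. job_wcet sys j) + (\<Sum>j\<in>Own. job_wcet sys j)"
    proof (rule add_le_less_mono)
      have le: "service \<rho> j (tb + R) \<le> job_wcet sys j" if "j \<in> jobs sys \<rho>" for j
        using service_le_exec_time[OF that, of "tb + R"] exec_time_le[OF that] tb R by simp
      show "(\<Sum>j\<in>I. service \<rho> j (tb + R)) \<le> (\<Sum>j\<in>I. job_wcet sys j)"
        using le I_jobs by (intro sum_mono) simp
      show "(\<Sum>j\<in>Own. service \<rho> j (tb + R)) < (\<Sum>j\<in>Own. job_wcet sys j)"
      proof (rule sum_strict_mono_ex1[OF finOwn])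
        show "\<forall>j\<in>Own. service \<rho> j (tb + R) \<le> job_wcet sys j" using le Own_jobs by simp
        show "\<exists>j\<in>Own. service \<rho> j (tb + R) < job_wcet sys j"
          using JOwn unf[of "tb + R"] exec_time_le[OF Jjob] by (meson less_le_trans order_refl)
      qed
    qed
    also have "(\<Sum>j\<in>Own. job_wcet sys j) = own_demand sys s n"
      unfolding Own_def sum_own_stages[OF n, symmetric]
      by (subst sum.reindex[OF inj]) (auto intro!: sum.cong)
    finally have "R < demand sys s n R" using I_le by (simp add: demand_def)
    with R(2) show False by simp
  qed
  then show ?thesis
    using t0 R by (intro finish_time_le) (simp_all add: t0_def R_def)
qed

section \<open>Data transfers and the steps of the recurrence\<close>

lemma start_time_ge_release: "ereal (real k * tick sys) \<le> start_time \<rho> s n k"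
  unfolding start_time_def
proof (rule INF_greatest)
  fix t assume "t \<in> occupied \<rho> (Stage s n k)"
  then have "pending sys \<rho> (Stage s n k) t" by (auto simp: occupied_def intro: running_pending)
  then show "ereal (real k * tick sys) \<le> ereal t" by (simp add: pending_def)
qed

text \<open>At any moment when the target runs, the source has been released and has priority, so it
  must be finished. For equal periods \<open>k = l\<close> is required because the bucket order
  compares only stages of the same release. A target that never starts has infinite start
  time.\<close>

lemma ordered_finish_le_start:
  assumes a: "a \<in> devices sys" "k \<in> release_indices sys a" and le: "k \<le> l"
    and ord: "period sys a < period sys b \<or>
      period sys a = period sys b \<and> k = l \<and>
      occurs_before (bucket_program sys (period sys a)) (s, a) (s, b)"
  shows "finish_time \<rho> s a k \<le> start_time \<rho> s b l"
  unfolding start_time_def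
proof (rule INF_greatest)
  fix t assume "t \<in> occupied \<rho> (Stage s b l)"
  then have t: "0 \<le> t" "sched \<rho> t = Some (Stage s b l)" by (auto simp: occupied_def)
  have "real l * tick sys \<le> t" using running_pending[OF t] by (simp add: pending_def)
  moreover have "real k * tick sys \<le> real l * tick sys" using le tick_pos by simp
  ultimately have "exec_time \<rho> (Stage s a k) \<le> service \<rho> (Stage s a k) t"
    using a ord by (intro higher_priority_done[OF t]) (auto simp: Stage_in_jobs)
  then show "finish_time \<rho> s a k \<le> ereal t" using t by (intro finish_time_le)
qed

lemma edges_devices: "edges sys \<subseteq> devices sys \<times> devices sys"
  using wf by (simp add: wf_system_def forest_def)

text \<open>The common form of \<^const>\<open>update_step\<close> and \<^const>\<open>handle_step\<close>.\<close>

definition index_step :: "bool \<Rightarrow> stage \<Rightarrow> nat \<Rightarrow> int \<Rightarrow> int" where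
  "index_step ord s a z =
     (if ord then \<lfloor>of_int z * tick sys / period sys a\<rfloor> * int (period_ticks sys a)
      else \<lfloor>(of_int z * tick sys - response_bound sys s a) / period sys a\<rfloor>
             * int (period_ticks sys a))"

text \<open>This lets an inequality between recurrence index and exact index survive the next
  step.\<close>

lemma index_step_mono:
  assumes "a \<in> devices sys" "z \<le> z'"
  shows "index_step ord s a z \<le> index_step ord s a z'"
proof -
  have "of_int z * tick sys \<le> of_int z' * tick sys"
    using assms(2) tick_pos by simp
  then show ?thesis
    using period_pos[OF assms(1)] unfolding index_step_def
    by (simp add: mult_right_mono floor_mono divide_right_mono)
qed

lemma transfers_devices:
  "transfers sys \<rho> s a k b l \<Longrightarrow> a \<in> devices sys \<and> b \<in> devices sys"
  using edges_devices by (cases s) (auto simp: transfers_def)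

text \<open>The step applied to the exact index \<kappa>2 yields a transfer candidate unless it is
  negative, and \<kappa>1 is the largest candidate. Monotonicity then passes from \<kappa>2 down to
  \<open>z\<close>.\<close>

lemma index_step_le_transfer:
  assumes tr: "transfers sys \<rho> s a \<kappa>1 b \<kappa>2" and z: "z \<le> int \<kappa>2"
    and \<kappa>2: "\<kappa>2 \<in> release_indices sys b"
    and ord: "ord \<Longrightarrow> period sys a < period sys b \<or>
      period sys a = period sys b \<and>
      occurs_before (bucket_program sys (period sys a)) (s, a) (s, b)"
  shows "index_step ord s a z \<le> int \<kappa>1"
proof -
  have a: "a \<in> devices sys"
    using transfers_devices[OF tr] by simp
  note pos = period_pos[OF a]
  let ?k = "index_step ord s a (int \<kappa>2)"
  have "?k \<le> int \<kappa>1"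
  \<comment> \<open>A negative index denotes no instance, but then the bound holds because \<kappa>1
    is a natural number.\<close>
  proof (cases "?k < 0")
    case False
    define k where "k = nat ?k"
    have k: "int k = ?k" using False by (simp add: k_def)
    have "int (period_ticks sys a) dvd int k" unfolding k index_step_def by simp
    then have krel: "k \<in> release_indices sys a" by (simp add: release_indices_iff)
    have floor_le: "of_int \<lfloor>x / period sys a\<rfloor> * real (period_ticks sys a) * tick sys \<le> x" for x
    proof -
      have "of_int \<lfloor>x / period sys a\<rfloor> * period sys a \<le> x / period sys a * period sys a"
        using pos by (intro mult_right_mono) auto
      also have "\<dots> = x" using pos by simp
      finally show ?thesis by (simp add: period_def mult.assoc)
    qed
    have "finish_time \<rho> s a k \<le> start_time \<rho> s b \<kappa>2"
    proof (cases ord)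
      case True
      have kk: "real k = of_int \<lfloor>real \<kappa>2 * tick sys / period sys a\<rfloor> * real (period_ticks sys a)"
        using arg_cong[OF k, of real_of_int] True by (simp add: index_step_def)
      have "real k * tick sys \<le> real \<kappa>2 * tick sys"
        unfolding kk by (rule floor_le)
      then have "k \<le> \<kappa>2" using tick_pos by simp
      \<comment> \<open>With equal periods \<kappa>2 is itself a release index of \<open>a\<close>,
        so the floor loses nothing and source and target belong to the same bucket release.\<close>
      moreover have "k = \<kappa>2" if eq: "period sys a = period sys b"
      proof -
        obtain q where q: "\<kappa>2 = period_ticks sys a * q"
          using \<kappa>2 eq by (auto simp: release_indices_iff period_ticks_eq)
        have "real \<kappa>2 * tick sys / period sys a = real q"
          using q tick_pos period_ticks_pos[OF a] by (simp add: period_def)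
        with kk have "real k = real \<kappa>2" by (simp add: q)
        then show ?thesis by simp
      qed
      ultimately show ?thesis
        using ord[OF True] by (intro ordered_finish_le_start[OF a krel]) auto
    next
      case False
      have kk: "real k =
          of_int \<lfloor>(real \<kappa>2 * tick sys - response_bound sys s a) / period sys a\<rfloor> *
          real (period_ticks sys a)"
        using arg_cong[OF k, of real_of_int] False by (simp add: index_step_def)
      have "real k * tick sys \<le> real \<kappa>2 * tick sys - response_bound sys s a"
        unfolding kk by (rule floor_le)
      then have le: "real k * tick sys + response_bound sys s a \<le> real \<kappa>2 * tick sys"
        by simp
      have "finish_time \<rho> s a k \<le> ereal (real k * tick sys + response_bound sys s a)"
        by (rule finish_time_le_response_bound[OF a krel])
      also have "\<dots> \<le> ereal (real \<kappa>2 * tick sys)" using le by simp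
      also have "\<dots> \<le> start_time \<rho> s b \<kappa>2" by (rule start_time_ge_release)
      finally show ?thesis .
    qed
    with tr krel have "k \<le> \<kappa>1"
      unfolding transfers_def transfer_candidates_def by blast
    then show ?thesis using k by simp
  qed simp
  with index_step_mono[OF a z, of ord s] show ?thesis by simp
qed

section \<open>Exact release indices along a path\<close>

lemma transfers_release:
  "transfers sys \<rho> s a k b l \<Longrightarrow> k \<in> release_indices sys a"
  by (simp add: transfers_def transfer_candidates_def)

text \<open>For the largest \<open>v\<close> this is the terminal index; every other one is the
  source index of the next Handle transfer towards the leaf.\<close>

lemma exact_index_release_Handle:
  assumes exact: "exact_indices sys \<rho> xs \<kappa>" and v: "v < length xs"
  shows "\<kappa> (length xs + v) \<in> release_indices sys (node xs (length xs - v))"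
proof (cases "Suc v = length xs")
  case True
  then have "length xs + v = 2 * length xs - 1" "length xs - v = 1" by auto
  with exact show ?thesis by (simp add: exact_indices_def Let_def)
next
  case False
  with v have "Suc v \<in> {1..length xs - 1}" by auto
  with exact have "transfers sys \<rho> Handle (node xs (length xs - Suc v + 1)) (\<kappa> (length xs + Suc v - 1))
      (node xs (length xs - Suc v)) (\<kappa> (length xs + Suc v))"
    unfolding exact_indices_def Let_def by blast
  moreover have "length xs - Suc v + 1 = length xs - v" using v by simp
  ultimately show ?thesis using transfers_release by simp
qed

lemma exact_index_release_Update:
  assumes exact: "exact_indices sys \<rho> xs \<kappa>" and u: "1 \<le> u" "u \<le> length xs"
  shows "\<kappa> u \<in> release_indices sys (node xs u)"
proof (cases "u = length xs")
  \<comment> \<open>The Update and the Handle of the root share one index, so this case is the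
    Handle lemma with \<open>v = 0\<close>.\<close>
  case True
  then have "0 < length xs" using u by linarith
  from exact_index_release_Handle[OF exact this] show ?thesis unfolding True by simp
next
  case False
  with u have "Suc u \<in> {2..length xs}" by auto
  with exact have "transfers sys \<rho> Update (node xs (Suc u - 1)) (\<kappa> (Suc u - 1))
      (node xs (Suc u)) (\<kappa> (Suc u))"
    unfolding exact_indices_def Let_def by blast
  then show ?thesis using transfers_release by simp
qed

text \<open>Both sequences start from the same terminal index, and each step preserves the
  inequality by \<open>index_step_le_transfer\<close>. The bound on \<open>i\<close> keeps all
  indices at least 1, so the truncated subtractions are harmless.\<close>

lemma backward_le_exact:
  assumes exact: "exact_indices sys \<rho> xs \<kappa>" and "i \<le> 2 * length xs - 2"
  shows "backward sys xs (\<kappa> (2 * length xs - 1)) i \<le> int (\<kappa> (2 * length xs - 1 - i))"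
  using assms(2)
proof (induction i)
  case 0
  then show ?case by simp
next
  case (Suc i)
  let ?P = "length xs"
  define j where "j = 2 * ?P - 1 - i"
  have j: "2 \<le> j" "j \<le> 2 * ?P - 1" "2 * ?P - 1 - Suc i = j - 1" using Suc.prems by (auto simp: j_def)
  define z where "z = backward sys xs (\<kappa> (2 * ?P - 1)) i"
  have z: "z \<le> int (\<kappa> j)" using Suc by (simp add: z_def j_def)
  show ?case
  proof (cases "j > ?P")
    case True
    define v where "v = j - ?P"
    let ?a = "node xs (?P - v + 1)" and ?b = "node xs (?P - v)"
    have v: "v \<in> {1..?P - 1}" "j = ?P + v" using True j by (auto simp: v_def)
    have tr: "transfers sys \<rho> Handle ?a (\<kappa> (j - 1)) ?b (\<kappa> j)"
      using exact v unfolding exact_indices_def Let_def by blast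
    have "index_step (handle_ordered sys xs v) Handle ?a z \<le> int (\<kappa> (j - 1))"
    proof (rule index_step_le_transfer[OF tr z])
      show "\<kappa> j \<in> release_indices sys ?b"
        using exact_index_release_Handle[OF exact, of v] v by auto
      assume "handle_ordered sys xs v"
      then show "period sys ?a < period sys ?b \<or> period sys ?a = period sys ?b \<and>
          occurs_before (bucket_program sys (period sys ?a)) (Handle, ?a) (Handle, ?b)"
        using transfers_devices[OF tr]
        by (auto simp: handle_ordered_def Let_def intro: bucket_program_Handle)
    qed
    moreover have "backward sys xs (\<kappa> (2 * ?P - 1)) (Suc i) = handle_step sys xs v z"
      using True by (simp add: j_def v_def z_def Let_def)
    ultimately show ?thesis
      using j(3) by (simp add: handle_step_def index_step_def Let_def)
  next
    case False
    let ?a = "node xs (j - 1)" and ?b = "node xs j"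
    have tr: "transfers sys \<rho> Update ?a (\<kappa> (j - 1)) ?b (\<kappa> j)"
      using exact j False unfolding exact_indices_def Let_def by (meson atLeastAtMost_iff not_less)
    have "index_step (update_ordered sys xs j) Update ?a z \<le> int (\<kappa> (j - 1))"
    proof (rule index_step_le_transfer[OF tr z])
      show "\<kappa> j \<in> release_indices sys ?b"
        using exact_index_release_Update[OF exact, of j] j False by auto
      assume "update_ordered sys xs j"
      then show "period sys ?a < period sys ?b \<or> period sys ?a = period sys ?b \<and>
          occurs_before (bucket_program sys (period sys ?a)) (Update, ?a) (Update, ?b)"
        using transfers_devices[OF tr]
        by (auto simp: update_ordered_def Let_def intro: bucket_program_Update)
    qed
    moreover have "backward sys xs (\<kappa> (2 * ?P - 1)) (Suc i) = update_step sys xs j z"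
      using False by (simp add: j_def z_def Let_def)
    ultimately show ?thesis
      using j(3) by (simp add: update_step_def index_step_def Let_def)
  qed
qed

section \<open>The latency bound\<close>

text \<open>The final Handle finishes within its response bound after its release, and the first
  Update starts no earlier than its release at \<open>\<kappa> 1\<close>, which the recurrence index
  does not exceed.\<close>

lemma exact_latency_le:
  assumes "xs \<noteq> []" and n: "node xs 1 \<in> devices sys" and exact: "exact_indices sys \<rho> xs \<kappa>"
  defines "k \<equiv> \<kappa> (2 * length xs - 1)"
  shows "finish_time \<rho> Handle (node xs 1) k - start_time \<rho> Update (node xs 1) (\<kappa> 1)
    \<le> ereal (real k * tick sys + response_bound sys Handle (node xs 1)
        - of_int (backward_index sys xs k 1) * tick sys)"
proof -
  have k: "k \<in> release_indices sys (node xs 1)"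
    using exact by (simp add: exact_indices_def Let_def k_def)
  \<comment> \<open>In truncated arithmetic this identity needs a nonempty path.\<close>
  have len: "2 * length xs - 1 - (2 * length xs - 2) = 1" using assms(1) by (cases xs) auto
  have "backward_index sys xs k 1 \<le> int (\<kappa> 1)"
    using backward_le_exact[OF exact order_refl, unfolded len]
    by (simp add: backward_index_def k_def numeral_2_eq_2)
  then have "of_int (backward_index sys xs k 1) \<le> real (\<kappa> 1)" by linarith
  then have le: "of_int (backward_index sys xs k 1) * tick sys \<le> real (\<kappa> 1) * tick sys"
    using tick_pos by simp
  have "finish_time \<rho> Handle (node xs 1) k - start_time \<rho> Update (node xs 1) (\<kappa> 1)
      \<le> ereal (real k * tick sys + response_bound sys Handle (node xs 1)) -
        ereal (real (\<kappa> 1) * tick sys)"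
    by (intro ereal_minus_mono finish_time_le_response_bound n k start_time_ge_release)
  also have "\<dots> \<le> ereal (real k * tick sys + response_bound sys Handle (node xs 1)
        - of_int (backward_index sys xs k 1) * tick sys)"
    using le by simp
  finally show ?thesis .
qed

end

theorem theorem3:
  fixes sys :: system and \<rho> :: run and V :: "nat set"
  assumes "wf_system sys"
    and "response_bounds_exist sys"
    and "wf_workload sys \<rho>"
    and "static_policy sys \<rho>"
    and "deadlines_met sys \<rho>"
    and "V \<in> trees sys"
  shows "decision_latency sys \<rho> V \<le>
    (SUP xs\<in>leaf_root_paths sys V. SUP k\<in>release_indices sys (node xs 1).
       ereal (real k * tick sys + response_bound sys Handle (node xs 1)
              - of_int (backward_index sys xs k 1) * tick sys))"
  unfolding decision_latency_def
proof (rule Sup_least, elim CollectE exE conjE)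
  interpret static_run sys \<rho> using assms(1-5) by (rule static_run.intro)
  fix x xs \<kappa>
  assume x: "x = finish_time \<rho> Handle (node xs 1) (\<kappa> (2 * length xs - 1)) -
      start_time \<rho> Update (node xs 1) (\<kappa> 1)"
    and xs: "xs \<in> leaf_root_paths sys V" and exact: "exact_indices sys \<rho> xs \<kappa>"
  have "V \<subseteq> devices sys"
    using assms(6) by (auto simp: trees_def quotient_def)
  moreover have "xs \<noteq> []" "set xs \<subseteq> V" using xs by (simp_all add: leaf_root_paths_def)
  ultimately have n: "xs \<noteq> []" "node xs 1 \<in> devices sys"
    by (auto simp: node_def subset_iff)
  \<comment> \<open>The supremum on the right is evaluated at the same path and at this terminal
    index, which therefore has to be a release index of the leaf.\<close>
  have "\<kappa> (2 * length xs - 1) \<in> release_indices sys (node xs 1)"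
    using exact by (simp add: exact_indices_def Let_def)
  then show "x \<le> (SUP xs\<in>leaf_root_paths sys V. SUP k\<in>release_indices sys (node xs 1).
       ereal (real k * tick sys + response_bound sys Handle (node xs 1)
              - of_int (backward_index sys xs k 1) * tick sys))"
    unfolding x using exact_latency_le[OF n exact] xs by (blast intro: SUP_upper2)
qed

end
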